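(* Let $0<\gamma<1$. Then, for all $x>0$, $$\int_0^x\mathrm{e}^{-\gamma t}t^\nu I_\nu(t)\,\mathrm{d}t<\frac{2(2\nu+7)}{(2\nu+1)(1-\gamma)}\mathrm{e}^{-\gamma x}x^\nu I_{\nu+1}(x),\quad \nu>-\tfrac12,$$ $$\int_0^x\mathrm{e}^{-\gamma t}t^\nu I_\nu(t)\,\mathrm{d}t<\frac{2\nu+7}{(2\nu+1)(1-\gamma)}\mathrm{e}^{-\gamma x}x^\nu I_\nu(x),\quad \nu>-\tfrac12,$$ $$\int_0^x\mathrm{e}^{-\gamma t}t^\nu I_\nu(t)\,\mathrm{d}t>\frac{1}{1-\gamma}\bigg\{1-\frac{4\nu(2\nu+5)}{(2\nu-1)(1-\gamma)}\frac{1}{x}\bigg\}\mathrm{e}^{-\gamma x}x^\nu I_\nu(x),\quad \nu>\tfrac12.$$ The lower bound $\int_0^x\mathrm{e}^{-\gamma t}t^\nu I_\nu(t)\,\mathrm{d}t>\frac{1}{1-\gamma}\big\{1-\frac{4\nu(2\nu+5)}{(2\nu-1)(1-\gamma)}\frac{1}{x}\big\}\mathrm{e}^{-\gamma x}x^\nu I_\nu(x)$ is tight as $x\to\infty$ (for each fixed $\nu>\tfrac12$ and $0<\gamma<1$).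
   Context: For $\nu\in\mathbb{R}$ and $x>0$, $I_\nu(x)=\sum_{k=0}^\infty \frac{(x/2)^{\nu+2k}}{\Gamma(\nu+k+1)\,k!}$ is the modified Bessel function of the first kind. An inequality between two functions of $x$ is called tight as $x\to\infty$ if the ratio of its two sides tends to $1$ as $x\to\infty$. *)

theory Defs
  imports "HOL-Analysis.Analysis"
begin

(* Intended for x > 0, where the series converges for every real nu.  At poles of Gamma the
   library has Gamma = 0 and hence division by it gives 0, so those terms vanish, as in the
   usual convention 1 / Gamma = 0. *)
definition Bessel_I :: "real \<Rightarrow> real \<Rightarrow> real" where
  "Bessel_I \<nu> x =
     (\<Sum>k. (x / 2) powr (\<nu> + 2 * real k) / (Gamma (\<nu> + real k + 1) * fact k))"

definition tight_at_infinity :: "(real \<Rightarrow> real) \<Rightarrow> (real \<Rightarrow> real) \<Rightarrow> bool" where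
  "tight_at_infinity f g \<longleftrightarrow> ((\<lambda>x. f x / g x) \<longlongrightarrow> 1) at_top"

definition Bessel_integrand :: "real \<Rightarrow> real \<Rightarrow> real \<Rightarrow> real" where
  "Bessel_integrand \<gamma> \<nu> t = exp (- \<gamma> * t) * t powr \<nu> * Bessel_I \<nu> t"

definition lower_bound :: "real \<Rightarrow> real \<Rightarrow> real \<Rightarrow> real" where
  "lower_bound \<gamma> \<nu> x =
     1 / (1 - \<gamma>) * (1 - 4 * \<nu> * (2 * \<nu> + 5) / ((2 * \<nu> - 1) * (1 - \<gamma>)) * (1 / x))
       * exp (- \<gamma> * x) * x powr \<nu> * Bessel_I \<nu> x"

end

theory Submission
  imports Defs
begin

text \<open>
  Write I(n, x) for the modified Bessel function. Two identities drive the proof. For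
  \<open>\<gamma> = 1\<close> the integral is explicit:
  (2n + 1) times the integral of exp(-t) t^n I(n, t) over [0, x] equals
  exp(-x) x^(n+1) (I(n, x) + I(n+1, x)). And x^(n+1) exp(x) (I(n, x) - I(n+1, x)) vanishes at 0
  and has derivative (2n + 1) x^n exp(x) I(n, x) > 0, whence I(n+1, x) < I(n, x).
  Each upper bound holds for \<open>x \<le> K / (1 - \<gamma>)\<close> because
  \<open>exp (- \<gamma> * t) \<le> exp ((1 - \<gamma>) * x) * exp (- t)\<close> reduces it to the explicit case, and for
  larger x because there the derivative of the right-hand side dominates the integrand
  (K = 2 for the bound by I(n+1, x), K = n + 7/2 for the bound by I(n, x)).
  For the lower bound, the derivative of \<open>exp (- \<gamma> * x)\<close> x^n I(n, x) exceeds \<open>1 - \<gamma>\<close> times the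
  integrand by \<open>exp (- \<gamma> * x)\<close> x^n (I(n-1, x) - I(n, x)). The last factor lies between 0 and
  2n I(n-1, x) / x, so the error is controlled by the first upper bound at n - 1.
\<close>

section \<open>The entire power series underlying the Bessel function\<close>

text \<open>With z = x^2 this is I(\<nu>, x) divided by (x/2)^\<nu>. Removing the non-integer power
  leaves an honest power series, which can be differentiated termwise, also at 0.\<close>

definition bessel_series :: "real \<Rightarrow> real \<Rightarrow> real" where
  "bessel_series \<nu> z = (\<Sum>k. 1 / (4 ^ k * fact k * Gamma (\<nu> + real k + 1)) * z ^ k)"

lemma Gamma_pos_shift: "\<nu> > -1 \<Longrightarrow> Gamma (\<nu> + real k + 1) > 0"
  by (intro Gamma_real_pos) auto

lemma Gamma_shift_Suc:
  "\<nu> > -1 \<Longrightarrow> Gamma (\<nu> + real (Suc k) + 1) = (\<nu> + real k + 1) * Gamma (\<nu> + real k + 1)"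
  using Gamma_plus1[of "\<nu> + real k + 1"] by (auto simp: nonpos_Ints_def algebra_simps)

lemma summable_bessel_series:
  fixes z :: real
  assumes "\<nu> > -1"
  shows "summable (\<lambda>k. 1 / (4 ^ k * fact k * Gamma (\<nu> + real k + 1)) * z ^ k)"
proof -
  \<comment> \<open>For n \<ge> \<open>N\<close> the factor \<nu> + n + 1 is at least |z|, so the
    ratio |z| / (4 (n+1) (\<nu>+n+1)) of consecutive terms is at most 1/2.\<close>
  define N where "N = nat \<lceil>\<bar>z\<bar> + \<bar>\<nu>\<bar> + 1\<rceil>"
  show ?thesis
  proof (rule summable_ratio_test[where c = "1/2" and N = N])
    fix n assume "n \<ge> N"
    hence n: "real n \<ge> \<bar>z\<bar> + \<bar>\<nu>\<bar> + 1" unfolding N_def by linarith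
    let ?G = "Gamma (\<nu> + real n + 1)"
    have "\<bar>z\<bar> * 1 \<le> (2 * real n + 2) * (\<nu> + real n + 1)"
      using n by (intro mult_mono) auto
    moreover have pos: "4 * (real n + 1) * (\<nu> + real n + 1) > 0"
      using n by (intro mult_pos_pos) auto
    ultimately have le: "\<bar>z\<bar> / (4 * (real n + 1) * (\<nu> + real n + 1)) \<le> 1 / 2"
      by (simp add: pos_divide_le_eq algebra_simps)
    have "1 / (4 ^ Suc n * fact (Suc n) * Gamma (\<nu> + real (Suc n) + 1)) * z ^ Suc n =
        z / (4 * (real n + 1) * (\<nu> + real n + 1)) * (1 / (4 ^ n * fact n * ?G) * z ^ n)"
      unfolding Gamma_shift_Suc[OF assms] by (simp add: mult_ac add_ac)
    hence "norm (1 / (4 ^ Suc n * fact (Suc n) * Gamma (\<nu> + real (Suc n) + 1)) * z ^ Suc n) =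
        \<bar>z\<bar> / (4 * (real n + 1) * (\<nu> + real n + 1)) * norm (1 / (4 ^ n * fact n * ?G) * z ^ n)"
      by (simp only: norm_mult real_norm_def abs_mult[of "z / _"] abs_divide[of z] abs_of_pos[OF pos])
    also have "\<dots> \<le> 1 / 2 * norm (1 / (4 ^ n * fact n * ?G) * z ^ n)"
      by (rule mult_right_mono[OF le]) simp
    finally show "norm (1 / (4 ^ Suc n * fact (Suc n) * Gamma (\<nu> + real (Suc n) + 1)) * z ^ Suc n)
        \<le> 1 / 2 * norm (1 / (4 ^ n * fact n * ?G) * z ^ n)" .
  qed simp
qed

lemma bessel_series_pos:
  assumes "\<nu> > -1" "z \<ge> 0"
  shows "bessel_series \<nu> z > 0"
  unfolding bessel_series_def
  by (rule suminf_pos2[OF summable_bessel_series[OF assms(1)], of z 0])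
    (use assms Gamma_pos_shift[OF assms(1)] in \<open>auto simp: less_imp_le\<close>)

lemma diffs_bessel_series:
  "diffs (\<lambda>k. 1 / (4 ^ k * fact k * Gamma (\<nu> + real k + 1))) =
    (\<lambda>k. 1 / 4 * (1 / (4 ^ k * fact k * Gamma (\<nu> + 1 + real k + 1))))"
proof
  fix k
  have *: "\<nu> + real (Suc k) + 1 = \<nu> + 1 + real k + 1" by simp
  show "diffs (\<lambda>k. 1 / (4 ^ k * fact k * Gamma (\<nu> + real k + 1))) k =
      1 / 4 * (1 / (4 ^ k * fact k * Gamma (\<nu> + 1 + real k + 1)))"
    unfolding diffs_def * by (simp del: of_nat_Suc)
qed

lemma DERIV_bessel_series:
  assumes "\<nu> > -1"
  shows "(bessel_series \<nu> has_real_derivative bessel_series (\<nu> + 1) z / 4) (at z)"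
proof -
  have "(bessel_series \<nu> has_real_derivative
      (\<Sum>k. diffs (\<lambda>k. 1 / (4 ^ k * fact k * Gamma (\<nu> + real k + 1))) k * z ^ k)) (at z)"
    unfolding bessel_series_def[abs_def]
    \<comment> \<open>Termwise differentiation at z needs convergence at some point of larger
      modulus; |z| + 1 is one.\<close>
    by (rule termdiffs_strong[of _ "\<bar>z\<bar> + 1"])
      (use summable_bessel_series[OF assms, of "\<bar>z\<bar> + 1"] in auto)
  also have "(\<Sum>k. diffs (\<lambda>k. 1 / (4 ^ k * fact k * Gamma (\<nu> + real k + 1))) k * z ^ k) =
      (\<Sum>k. 1 / 4 * (1 / (4 ^ k * fact k * Gamma (\<nu> + 1 + real k + 1)) * z ^ k))"
    unfolding diffs_bessel_series by (simp only: mult.assoc)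
  also have "\<dots> = bessel_series (\<nu> + 1) z / 4"
    unfolding bessel_series_def
    by (subst suminf_mult[OF summable_bessel_series]) (use assms in auto)
  finally show ?thesis .
qed

text \<open>By the functional equation of Gamma, the k-th coefficient for \<nu> is (\<nu> + 1) + k
  times the one for \<nu> + 1. The constant part gives the first summand; the weight k cancels in k!
  and shifts the index, which gives the second.\<close>

lemma bessel_series_recurrence:
  assumes "\<nu> > -1"
  shows "bessel_series \<nu> z = (\<nu> + 1) * bessel_series (\<nu> + 1) z + z / 4 * bessel_series (\<nu> + 2) z"
proof -
  define b where "b = (\<lambda>k. 1 / (4 ^ k * fact k * Gamma (\<nu> + 1 + real k + 1)) :: real)"
  define c where "c = (\<lambda>k. 1 / (4 ^ k * fact k * Gamma (\<nu> + 2 + real k + 1)) :: real)"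
  have b: "(\<lambda>k. b k * z ^ k) sums bessel_series (\<nu> + 1) z"
    unfolding b_def bessel_series_def using summable_bessel_series[of "\<nu> + 1" z] assms
    by (intro summable_sums) auto
  have bc: "real (Suc k) * b (Suc k) = c k / 4" for k
  proof -
    have *: "\<nu> + 1 + real (Suc k) + 1 = \<nu> + 2 + real k + 1" by simp
    show ?thesis unfolding b_def c_def * by (simp del: of_nat_Suc)
  qed
  have "(\<lambda>k. c k * z ^ k) sums bessel_series (\<nu> + 2) z"
    unfolding c_def bessel_series_def using summable_bessel_series[of "\<nu> + 2" z] assms
    by (intro summable_sums) auto
  from sums_mult[OF this, of "z / 4"]
  have "(\<lambda>k. real (Suc k) * b (Suc k) * z ^ Suc k) sums (z / 4 * bessel_series (\<nu> + 2) z)"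
    unfolding bc by (simp add: mult_ac)
  \<comment> \<open>The weight k makes the term at k = 0 vanish, so undoing the index shift leaves
    the sum unchanged.\<close>
  hence kb: "(\<lambda>k. real k * b k * z ^ k) sums (z / 4 * bessel_series (\<nu> + 2) z)"
    by (subst (asm) sums_Suc_iff) simp
  have "1 / (4 ^ k * fact k * Gamma (\<nu> + real k + 1)) * z ^ k =
      (\<nu> + 1) * (b k * z ^ k) + real k * b k * z ^ k" for k
  proof -
    have "Gamma (\<nu> + 1 + real k + 1) = (\<nu> + real k + 1) * Gamma (\<nu> + real k + 1)"
      using Gamma_shift_Suc[OF assms, of k] by (simp add: algebra_simps)
    moreover have "\<nu> + real k + 1 > 0" using assms by simp
    ultimately have "1 / (4 ^ k * fact k * Gamma (\<nu> + real k + 1)) = (\<nu> + real k + 1) * b k"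
      unfolding b_def by simp
    thus ?thesis by (simp add: algebra_simps)
  qed
  with sums_add[OF sums_mult[OF b, of "\<nu> + 1"] kb] show ?thesis
    unfolding bessel_series_def[of \<nu>] by (simp add: sums_iff)
qed

section \<open>Recurrence, derivatives and continuity of the Bessel function\<close>

lemma Bessel_I_eq:
  assumes "\<nu> > -1" "x > 0"
  shows "Bessel_I \<nu> x = 2 powr (-\<nu>) * x powr \<nu> * bessel_series \<nu> (x\<^sup>2)"
proof -
  have "(x / 2) powr (\<nu> + 2 * real k) / (Gamma (\<nu> + real k + 1) * fact k) =
      2 powr (-\<nu>) * x powr \<nu> * (1 / (4 ^ k * fact k * Gamma (\<nu> + real k + 1)) * (x\<^sup>2) ^ k)" for k
  proof -
    have "(x / 2) powr (2 * real k) = (x\<^sup>2) ^ k / 4 ^ k"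
      using assms powr_realpow[of "x / 2" "2 * k"]
      by (simp add: power_mult power_divide)
    moreover have "(x / 2) powr \<nu> = 2 powr (-\<nu>) * x powr \<nu>"
      using assms by (simp add: powr_divide powr_minus field_simps)
    ultimately show ?thesis by (simp add: powr_add)
  qed
  thus ?thesis unfolding Bessel_I_def bessel_series_def
    by (simp only:) (rule suminf_mult[OF summable_bessel_series[OF assms(1)]])
qed

lemma Bessel_I_pos: "\<nu> > -1 \<Longrightarrow> x > 0 \<Longrightarrow> Bessel_I \<nu> x > 0"
  by (simp add: Bessel_I_eq bessel_series_pos)

lemma Bessel_I_recurrence:
  assumes "\<nu> > -1" "x > 0"
  shows "Bessel_I \<nu> x = 2 * (\<nu> + 1) / x * Bessel_I (\<nu> + 1) x + Bessel_I (\<nu> + 2) x"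
proof -
  have x: "x powr (\<nu> + 1) = x powr \<nu> * x" "x powr (\<nu> + 2) = x powr \<nu> * x\<^sup>2"
    "2 powr (- (\<nu> + 1)) = 2 powr (-\<nu>) / 2" "2 powr (- (\<nu> + 2)) = 2 powr (-\<nu>) / 4"
    using assms by (simp_all add: powr_add powr_diff powr_minus field_simps)
  have \<nu>: "\<nu> + 1 > -1" "\<nu> + 2 > -1" using assms by auto
  show ?thesis
    unfolding Bessel_I_eq[OF assms] Bessel_I_eq[OF \<nu>(1) assms(2)] Bessel_I_eq[OF \<nu>(2) assms(2)]
      bessel_series_recurrence[OF assms(1), of "x\<^sup>2"] x
    using assms by (simp add: field_simps)
qed

lemma DERIV_Bessel_I:
  assumes "\<nu> > -1" "x > 0"
  shows "(Bessel_I \<nu> has_real_derivative \<nu> / x * Bessel_I \<nu> x + Bessel_I (\<nu> + 1) x) (at x)"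
proof -
  have Suc: "Bessel_I (\<nu> + 1) x = 2 powr (-\<nu>) / 2 * (x powr \<nu> * x) * bessel_series (\<nu> + 1) (x\<^sup>2)"
    using assms Bessel_I_eq[of "\<nu> + 1" x] by (simp add: powr_add powr_diff powr_minus field_simps)
  have "((\<lambda>x. bessel_series \<nu> (x\<^sup>2)) has_real_derivative
      bessel_series (\<nu> + 1) (x\<^sup>2) / 4 * (2 * x)) (at x)"
    by (rule DERIV_chain2[OF DERIV_bessel_series[OF assms(1)]])
      (auto intro!: derivative_eq_intros)
  from DERIV_mult[OF DERIV_cmult[OF has_real_derivative_powr[OF assms(2)]] this]
  have "((\<lambda>x. 2 powr (-\<nu>) * x powr \<nu> * bessel_series \<nu> (x\<^sup>2)) has_real_derivative
      \<nu> / x * Bessel_I \<nu> x + Bessel_I (\<nu> + 1) x) (at x)"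
    by (rule DERIV_cong)
      (unfold Bessel_I_eq[OF assms] Suc, use assms in \<open>simp add: powr_diff field_simps\<close>)
  thus ?thesis
    by (rule has_field_derivative_transform_within_open[where S = "{0<..}"])
      (use assms in \<open>auto simp: Bessel_I_eq\<close>)
qed

text \<open>A common template: the functions compared with integrals below are combinations of
  these, with \<open>c\<close> equal to 1, -1 or -\<gamma>.\<close>

lemma DERIV_exp_powr_Bessel_I:
  assumes "\<nu> > -1" "x > 0"
  shows "((\<lambda>x. exp (c * x) * x powr p * Bessel_I \<nu> x) has_real_derivative
    exp (c * x) * x powr p * ((c + (p + \<nu>) / x) * Bessel_I \<nu> x + Bessel_I (\<nu> + 1) x)) (at x)"
proof -
  have "((\<lambda>x. exp (c * x)) has_real_derivative exp (c * x) * c) (at x)"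
    by (auto intro!: derivative_eq_intros)
  from DERIV_mult[OF DERIV_mult[OF this has_real_derivative_powr[OF assms(2), of p]] DERIV_Bessel_I[OF assms]]
  show ?thesis
    by (rule DERIV_cong) (use assms in \<open>simp add: powr_diff field_simps\<close>)
qed

text \<open>Eliminating order \<nu> + 2 by the recurrence expresses the derivative through orders
  \<nu> and \<nu> + 1 only, so it can be combined with the template at order \<nu>. For
  \<open>p\<close> = \<nu> + 1 the 1/x term disappears.\<close>

lemma DERIV_exp_powr_Bessel_I_Suc:
  assumes "\<nu> > -1" "x > 0"
  shows "((\<lambda>x. exp (c * x) * x powr p * Bessel_I (\<nu> + 1) x) has_real_derivative
    exp (c * x) * x powr p * ((c + (p - \<nu> - 1) / x) * Bessel_I (\<nu> + 1) x + Bessel_I \<nu> x)) (at x)"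
proof -
  have "\<nu> + 1 > -1" using assms by simp
  from DERIV_exp_powr_Bessel_I[OF this assms(2), of c p] show ?thesis
    by (rule DERIV_cong)
      (use assms in \<open>simp add: Bessel_I_recurrence[of \<nu> x] field_simps\<close>)
qed

text \<open>At the left end point \<open>0 powr p = 0\<close> for every \<open>p\<close>, which is the limit since \<open>p + \<nu> > 0\<close>.\<close>
lemma continuous_on_exp_powr_Bessel_I:
  assumes "\<nu> > -1" "p + \<nu> > 0" "a \<ge> 0"
  shows "continuous_on {a..b} (\<lambda>x. exp (c * x) * x powr p * Bessel_I \<nu> x)"
proof -
  have cont: "continuous_on A (bessel_series \<nu>)" for A
    by (meson DERIV_bessel_series[OF assms(1)] DERIV_isCont continuous_at_imp_continuous_on)
  have "continuous_on {a..b}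
      (\<lambda>x. exp (c * x) * (2 powr (-\<nu>) * (x powr (p + \<nu>) * bessel_series \<nu> (x\<^sup>2))))"
    by (intro continuous_intros continuous_on_compose2[OF cont[of UNIV]] continuous_on_powr')
      (use assms in auto)
  thus ?thesis
  proof (rule continuous_on_eq)
    fix x assume "x \<in> {a..b}"
    thus "exp (c * x) * (2 powr (-\<nu>) * (x powr (p + \<nu>) * bessel_series \<nu> (x\<^sup>2))) =
        exp (c * x) * x powr p * Bessel_I \<nu> x"
      using assms by (cases "x = 0") (auto simp: Bessel_I_eq powr_add)
  qed
qed

section \<open>Monotonicity in the order, the explicit integral and integrability\<close>

lemma Bessel_I_Suc_less:
  assumes "\<nu> > -1/2" "x > 0"
  shows "Bessel_I (\<nu> + 1) x < Bessel_I \<nu> x"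
proof -
  \<comment> \<open>With the exponent \<nu> + 1 everything in the derivative of the difference
    cancels except (2\<nu> + 1)/t times I(\<nu>, t). The assumption \<nu> > -1/2 makes this positive
    and gives continuity at 0.\<close>
  define Q where "Q = (\<lambda>x. exp (1 * x) * x powr (\<nu> + 1) * Bessel_I \<nu> x
      - exp (1 * x) * x powr (\<nu> + 1) * Bessel_I (\<nu> + 1) x)"
  have "Q 0 < Q x"
  proof (rule DERIV_pos_imp_increasing_open[OF assms(2)])
    fix t :: real assume t: "0 < t" "t < x"
    have "(Q has_real_derivative exp t * t powr (\<nu> + 1) * ((2 * \<nu> + 1) / t * Bessel_I \<nu> t)) (at t)"
      unfolding Q_def
      by (rule DERIV_cong[OF DERIV_diff[OF DERIV_exp_powr_Bessel_I DERIV_exp_powr_Bessel_I_Suc]])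
        (use assms t in \<open>auto simp: algebra_simps add_divide_distrib\<close>)
    moreover have "exp t * t powr (\<nu> + 1) * ((2 * \<nu> + 1) / t * Bessel_I \<nu> t) > 0"
      using assms t by (simp add: Bessel_I_pos)
    ultimately show "\<exists>y. (Q has_real_derivative y) (at t) \<and> 0 < y" by blast
  next
    show "continuous_on {0..x} Q" unfolding Q_def
      by (intro continuous_on_diff continuous_on_exp_powr_Bessel_I) (use assms in auto)
  qed
  hence "0 < exp x * x powr (\<nu> + 1) * (Bessel_I \<nu> x - Bessel_I (\<nu> + 1) x)"
    by (simp add: Q_def algebra_simps)
  moreover have "exp x * x powr (\<nu> + 1) > 0" using assms by simp
  ultimately have "0 < Bessel_I \<nu> x - Bessel_I (\<nu> + 1) x" by (rule zero_less_mult_pos)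
  thus ?thesis by simp
qed

lemma integral_le_FTC:
  fixes f \<Phi> :: "real \<Rightarrow> real"
  assumes "a \<le> b" "continuous_on {a..b} \<Phi>" "f integrable_on {a..b}"
    and "\<And>t. a < t \<Longrightarrow> t < b \<Longrightarrow> (\<Phi> has_real_derivative D t) (at t)"
    and "\<And>t. a < t \<Longrightarrow> t < b \<Longrightarrow> f t \<le> D t"
  shows "integral {a..b} f \<le> \<Phi> b - \<Phi> a"
proof -
  \<comment> \<open>Nothing is known about \<open>D\<close> at the end points, so \<open>f\<close>
    replaces it there. The pointwise comparison then holds on the closed interval.\<close>
  have "((\<lambda>t. if a < t \<and> t < b then D t else f t) has_integral (\<Phi> b - \<Phi> a)) {a..b}"
    by (rule fundamental_theorem_of_calculus_interior)
      (use assms in \<open>auto simp: has_real_derivative_iff_has_vector_derivative[symmetric]\<close>)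
  from has_integral_le[OF integrable_integral[OF assms(3)] this] assms(5) show ?thesis by auto
qed

text \<open>For \<nu> < 0 the integrand blows up like t^(2\<nu>) at 0. The antiderivative
  \<open>P\<close> is still continuous there, so the interior fundamental theorem yields
  integrability and value together.\<close>

lemma has_integral_exp_minus_Bessel_I:
  assumes "\<nu> > -1/2" "x \<ge> 0"
  shows "(Bessel_integrand 1 \<nu> has_integral
    x powr (\<nu> + 1) * exp (-x) * (Bessel_I \<nu> x + Bessel_I (\<nu> + 1) x) / (2 * \<nu> + 1)) {0..x}"
proof -
  define P where "P = (\<lambda>x. (exp (-1 * x) * x powr (\<nu> + 1) * Bessel_I \<nu> x
      + exp (-1 * x) * x powr (\<nu> + 1) * Bessel_I (\<nu> + 1) x) / (2 * \<nu> + 1))"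
  have "(Bessel_integrand 1 \<nu> has_integral (P x - P 0)) {0..x}"
  proof (rule fundamental_theorem_of_calculus_interior)
    show "continuous_on {0..x} P" unfolding P_def
      by (intro continuous_on_divide continuous_on_add continuous_on_exp_powr_Bessel_I)
        (use assms in auto)
  next
    fix t assume t: "t \<in> {0<..<x}"
    have "(P has_real_derivative
        exp (-1 * t) * t powr (\<nu> + 1) * ((2 * \<nu> + 1) / t * Bessel_I \<nu> t) / (2 * \<nu> + 1)) (at t)"
      unfolding P_def
      by (intro DERIV_cdivide, rule DERIV_cong[OF DERIV_add
            [OF DERIV_exp_powr_Bessel_I DERIV_exp_powr_Bessel_I_Suc]])
        (use assms t in \<open>auto simp: algebra_simps add_divide_distrib\<close>)
    moreover have "exp (-1 * t) * t powr (\<nu> + 1) * ((2 * \<nu> + 1) / t * Bessel_I \<nu> t) / (2 * \<nu> + 1) =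
        Bessel_integrand 1 \<nu> t"
      using assms t by (simp add: Bessel_integrand_def powr_add)
    ultimately show "(P has_vector_derivative Bessel_integrand 1 \<nu> t) (at t)"
      by (simp add: has_real_derivative_iff_has_vector_derivative)
  qed (use assms in simp)
  thus ?thesis by (simp add: P_def algebra_simps)
qed

lemma Bessel_integrand_eq:
  "Bessel_integrand \<gamma> \<nu> t = exp ((1 - \<gamma>) * t) * Bessel_integrand 1 \<nu> t"
proof -
  have "- \<gamma> * t = (1 - \<gamma>) * t + - 1 * t" by (simp add: algebra_simps)
  hence "exp (- \<gamma> * t) = exp ((1 - \<gamma>) * t) * exp (- 1 * t)" by (simp only: exp_add)
  thus ?thesis unfolding Bessel_integrand_def by (simp only: mult.assoc)
qed

lemma Bessel_integrand_nonneg: "\<nu> > -1 \<Longrightarrow> t \<ge> 0 \<Longrightarrow> Bessel_integrand \<gamma> \<nu> t \<ge> 0"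
  by (cases "t = 0") (auto simp: Bessel_integrand_def less_imp_le Bessel_I_pos)

text \<open>Continuity is no help for \<nu> \<le> 0, where it fails at 0. Instead, the nonnegative
  integrand for \<gamma> = 1 is absolutely integrable, and the factor exp((1 - \<gamma>) t) is
  bounded and continuous.\<close>

lemma Bessel_integrand_integrable:
  assumes "\<nu> > -1/2" "a \<ge> 0"
  shows "Bessel_integrand \<gamma> \<nu> integrable_on {a..x}"
proof (cases "a \<le> x")
  case True
  have "Bessel_integrand 1 \<nu> absolutely_integrable_on {0..x}"
  proof (rule nonnegative_absolutely_integrable_1)
    show "Bessel_integrand 1 \<nu> integrable_on {0..x}"
      by (rule has_integral_integrable[OF has_integral_exp_minus_Bessel_I]) (use assms True in auto)
    show "0 \<le> Bessel_integrand 1 \<nu> t" if "t \<in> {0..x}" for t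
      by (rule Bessel_integrand_nonneg) (use assms that in auto)
  qed
  moreover have cont: "continuous_on {0..x} (\<lambda>t. exp ((1 - \<gamma>) * t))"
    by (intro continuous_intros)
  ultimately have "(\<lambda>t. exp ((1 - \<gamma>) * t) * Bessel_integrand 1 \<nu> t) absolutely_integrable_on {0..x}"
    by (intro absolutely_integrable_bounded_measurable_product_real
        continuous_imp_measurable_on_sets_lebesgue[OF cont]
        compact_imp_bounded[OF compact_continuous_image[OF cont]]) simp_all
  hence "Bessel_integrand \<gamma> \<nu> integrable_on {0..x}"
    unfolding Bessel_integrand_eq[of \<gamma>, abs_def] by (rule absolutely_integrable_on_def[THEN iffD1, THEN conjunct1])
  thus ?thesis by (rule integrable_on_subinterval) (use assms in auto)
qed auto

text \<open>The factor exp((1 - \<gamma>) t) is increasing, so its value at x comes out of the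
  explicit integral. The price is an extra factor x, harmless only on a bounded range.\<close>

lemma Bessel_integral_le:
  assumes "\<nu> > -1/2" "x > 0" "\<gamma> < 1"
  shows "integral {0..x} (Bessel_integrand \<gamma> \<nu>) \<le>
    exp (- \<gamma> * x) * x powr \<nu> * (x * (Bessel_I \<nu> x + Bessel_I (\<nu> + 1) x) / (2 * \<nu> + 1))"
proof -
  have "integral {0..x} (Bessel_integrand \<gamma> \<nu>) \<le>
      exp ((1 - \<gamma>) * x) * (x powr (\<nu> + 1) * exp (-x) * (Bessel_I \<nu> x + Bessel_I (\<nu> + 1) x) / (2 * \<nu> + 1))"
  proof (rule has_integral_le)
    show "(Bessel_integrand \<gamma> \<nu> has_integral integral {0..x} (Bessel_integrand \<gamma> \<nu>)) {0..x}"
      using assms by (intro integrable_integral Bessel_integrand_integrable) auto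
    show "((\<lambda>t. exp ((1 - \<gamma>) * x) * Bessel_integrand 1 \<nu> t) has_integral
      exp ((1 - \<gamma>) * x) * (x powr (\<nu> + 1) * exp (-x) *
        (Bessel_I \<nu> x + Bessel_I (\<nu> + 1) x) / (2 * \<nu> + 1))) {0..x}"
      using assms by (intro has_integral_mult_right has_integral_exp_minus_Bessel_I) auto
    fix t assume t: "t \<in> {0..x}"
    have "exp ((1 - \<gamma>) * t) \<le> exp ((1 - \<gamma>) * x)" using assms t by simp
    moreover have "Bessel_integrand 1 \<nu> t \<ge> 0"
      by (rule Bessel_integrand_nonneg) (use assms t in auto)
    ultimately show "Bessel_integrand \<gamma> \<nu> t \<le> exp ((1 - \<gamma>) * x) * Bessel_integrand 1 \<nu> t"
      unfolding Bessel_integrand_eq[of \<gamma>] by (rule mult_right_mono)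
  qed
  also have "\<dots> = (exp ((1 - \<gamma>) * x) * exp (-x)) * x powr \<nu> *
      (x * (Bessel_I \<nu> x + Bessel_I (\<nu> + 1) x) / (2 * \<nu> + 1))"
    using assms by (simp add: powr_add)
  also have "exp ((1 - \<gamma>) * x) * exp (-x) = exp (- \<gamma> * x)"
    unfolding exp_add[symmetric] by (rule arg_cong[where f = exp]) (simp add: algebra_simps)
  finally show ?thesis .
qed

section \<open>The two upper bounds\<close>

text \<open>Beyond \<open>a\<close> the increment of the integral is at most that of
  \<open>\<Phi>\<close>, so the strict inequality at \<open>a\<close> itself persists.\<close>

lemma Bessel_integral_less_extend:
  fixes \<Phi> :: "real \<Rightarrow> real"
  assumes "\<nu> > -1/2" "x > 0" "a > 0"
    and small: "\<And>y. 0 < y \<Longrightarrow> y \<le> a \<Longrightarrow> integral {0..y} (Bessel_integrand \<gamma> \<nu>) < \<Phi> y"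
    and der: "\<And>t. t > 0 \<Longrightarrow> (\<Phi> has_real_derivative D t) (at t)"
    and large: "\<And>t. t > a \<Longrightarrow> Bessel_integrand \<gamma> \<nu> t \<le> D t"
  shows "integral {0..x} (Bessel_integrand \<gamma> \<nu>) < \<Phi> x"
proof (cases "x \<le> a")
  case False
  have "integral {0..x} (Bessel_integrand \<gamma> \<nu>) =
      integral {0..a} (Bessel_integrand \<gamma> \<nu>) + integral {a..x} (Bessel_integrand \<gamma> \<nu>)"
    using assms False
    by (intro Henstock_Kurzweil_Integration.integral_combine[symmetric] Bessel_integrand_integrable) auto
  moreover have "integral {a..x} (Bessel_integrand \<gamma> \<nu>) \<le> \<Phi> x - \<Phi> a"
  proof (rule integral_le_FTC[where D = D])
    show "continuous_on {a..x} \<Phi>"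
      by (intro continuous_at_imp_continuous_on ballI DERIV_isCont[OF der]) (use assms in auto)
  qed (use assms False der large in \<open>auto intro: Bessel_integrand_integrable\<close>)
  ultimately show ?thesis using small[OF assms(3) order_refl] by linarith
qed (use assms in auto)

lemma Bessel_integral_less_Suc:
  assumes "\<nu> > -1/2" "x > 0" "0 < \<gamma>" "\<gamma> < 1"
  shows "integral {0..x} (Bessel_integrand \<gamma> \<nu>) <
    2 * (2 * \<nu> + 7) / ((2 * \<nu> + 1) * (1 - \<gamma>)) * exp (- \<gamma> * x) * x powr \<nu> * Bessel_I (\<nu> + 1) x"
proof -
  define C where "C = 2 * (2 * \<nu> + 7) / ((2 * \<nu> + 1) * (1 - \<gamma>))"
  define D where "D = (\<lambda>t. exp (-\<gamma> * t) * t powr \<nu> *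
      ((-\<gamma> + (\<nu> - \<nu> - 1) / t) * Bessel_I (\<nu> + 1) t + Bessel_I \<nu> t))"
  have "integral {0..x} (Bessel_integrand \<gamma> \<nu>) <
      C * (exp (-\<gamma> * x) * x powr \<nu> * Bessel_I (\<nu> + 1) x)"
  \<comment> \<open>Past this threshold 1/t \<le> (1 - \<gamma>)/2, which keeps \<gamma> + 1/t at
    most (1 + \<gamma>)/2 < 1; before it y (1 - \<gamma>) \<le> 2, which tames the factor y.\<close>
  proof (rule Bessel_integral_less_extend[where a = "2 / (1 - \<gamma>)"
        and \<Phi> = "\<lambda>x. C * (exp (-\<gamma> * x) * x powr \<nu> * Bessel_I (\<nu> + 1) x)" and D = "\<lambda>t. C * D t"])
    fix t :: real assume "t > 0"
    thus "((\<lambda>x. C * (exp (-\<gamma> * x) * x powr \<nu> * Bessel_I (\<nu> + 1) x)) has_real_derivative C * D t) (at t)"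
      unfolding D_def using assms by (intro DERIV_cmult DERIV_exp_powr_Bessel_I_Suc) auto
  next
    fix y :: real assume y: "0 < y" "y \<le> 2 / (1 - \<gamma>)"
    \<comment> \<open>The target involves order \<nu> + 1 only; the factor y absorbs the 1/y in the
      recurrence, so I(\<nu>, y) can be traded upwards.\<close>
    have "y * Bessel_I \<nu> y = 2 * (\<nu> + 1) * Bessel_I (\<nu> + 1) y + y * Bessel_I (\<nu> + 1 + 1) y"
      using Bessel_I_recurrence[of \<nu> y] assms y by (simp add: field_simps)
    moreover have "y * Bessel_I (\<nu> + 1 + 1) y < y * Bessel_I (\<nu> + 1) y"
      using Bessel_I_Suc_less[of "\<nu> + 1" y] assms y by simp
    ultimately have 1: "y * (Bessel_I \<nu> y + Bessel_I (\<nu> + 1) y) <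
        (2 * y + 2 * \<nu> + 2) * Bessel_I (\<nu> + 1) y"
      by (simp add: algebra_simps)
    have "(2 * y + 2 * \<nu> + 2) * (1 - \<gamma>) = 2 * (y * (1 - \<gamma>)) + (2 * \<nu> + 2) * (1 - \<gamma>)"
      by (simp add: algebra_simps)
    also have "\<dots> \<le> 2 * 2 + (2 * \<nu> + 2)"
      using y assms
      by (intro add_mono mult_left_mono mult_left_le) (auto simp: pos_le_divide_eq)
    also have "\<dots> \<le> 2 * (2 * \<nu> + 7)" using assms by simp
    finally have "(2 * y + 2 * \<nu> + 2) * (1 - \<gamma>) \<le> 2 * (2 * \<nu> + 7)" .
    hence 2: "2 * y + 2 * \<nu> + 2 \<le> 2 * (2 * \<nu> + 7) / (1 - \<gamma>)"
      using assms by (simp add: pos_le_divide_eq)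
    have "y * (Bessel_I \<nu> y + Bessel_I (\<nu> + 1) y) / (2 * \<nu> + 1) <
        2 * (2 * \<nu> + 7) / (1 - \<gamma>) * Bessel_I (\<nu> + 1) y / (2 * \<nu> + 1)"
      using assms y mult_right_mono[OF 2, of "Bessel_I (\<nu> + 1) y"] Bessel_I_pos[of "\<nu> + 1" y] 1
      by (intro divide_strict_right_mono) auto
    also have "\<dots> = C * Bessel_I (\<nu> + 1) y" by (simp add: C_def)
    finally have "exp (-\<gamma> * y) * y powr \<nu> * (y * (Bessel_I \<nu> y + Bessel_I (\<nu> + 1) y) / (2 * \<nu> + 1))
        < exp (-\<gamma> * y) * y powr \<nu> * (C * Bessel_I (\<nu> + 1) y)"
      using y by (intro mult_strict_left_mono) auto
    with Bessel_integral_le[of \<nu> y \<gamma>] assms y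
    show "integral {0..y} (Bessel_integrand \<gamma> \<nu>) < C * (exp (-\<gamma> * y) * y powr \<nu> * Bessel_I (\<nu> + 1) y)"
      by (simp add: mult_ac)
  next
    fix t :: real assume t: "t > 2 / (1 - \<gamma>)"
    hence t0: "t > 0" using assms by (meson divide_pos_pos less_trans diff_gt_0_iff_gt zero_less_numeral)
    have "1 / t \<le> (1 - \<gamma>) / 2" using t t0 assms by (simp add: field_simps)
    hence "(\<gamma> + 1 / t) * Bessel_I (\<nu> + 1) t \<le> (1 + \<gamma>) / 2 * Bessel_I \<nu> t"
      using Bessel_I_Suc_less[of \<nu> t] Bessel_I_pos[of "\<nu> + 1" t] assms t0
      by (intro mult_mono) (auto simp: field_simps)
    moreover have "(1 - \<gamma>) / 2 * Bessel_I \<nu> t = Bessel_I \<nu> t - (1 + \<gamma>) / 2 * Bessel_I \<nu> t"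
      by (simp add: field_simps)
    moreover have "(-\<gamma> + (\<nu> - \<nu> - 1) / t) * Bessel_I (\<nu> + 1) t = - ((\<gamma> + 1 / t) * Bessel_I (\<nu> + 1) t)"
      by (simp add: algebra_simps)
    ultimately have "(1 - \<gamma>) / 2 * Bessel_I \<nu> t \<le>
        (-\<gamma> + (\<nu> - \<nu> - 1) / t) * Bessel_I (\<nu> + 1) t + Bessel_I \<nu> t"
      by linarith
    \<comment> \<open>The product is (2\<nu> + 7)/(2\<nu> + 1).\<close>
    moreover have "C * ((1 - \<gamma>) / 2) \<ge> 1" using assms by (simp add: C_def divide_simps)
    hence "1 * Bessel_I \<nu> t \<le> C * ((1 - \<gamma>) / 2) * Bessel_I \<nu> t"
      using Bessel_I_pos[of \<nu> t] assms t0 by (intro mult_right_mono) auto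
    moreover have "C > 0" using assms by (simp add: C_def)
    ultimately have "Bessel_I \<nu> t \<le> C * ((-\<gamma> + (\<nu> - \<nu> - 1) / t) * Bessel_I (\<nu> + 1) t + Bessel_I \<nu> t)"
      by (smt (verit) mult.assoc mult_left_mono)
    hence "exp (-\<gamma> * t) * t powr \<nu> * Bessel_I \<nu> t \<le> exp (-\<gamma> * t) * t powr \<nu> *
        (C * ((-\<gamma> + (\<nu> - \<nu> - 1) / t) * Bessel_I (\<nu> + 1) t + Bessel_I \<nu> t))"
      by (intro mult_left_mono) auto
    thus "Bessel_integrand \<gamma> \<nu> t \<le> C * D t" by (simp only: Bessel_integrand_def D_def mult_ac)
  qed (use assms in auto)
  thus ?thesis by (simp only: C_def mult.assoc)
qed

lemma Bessel_integral_less: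
  assumes "\<nu> > -1/2" "x > 0" "0 < \<gamma>" "\<gamma> < 1"
  shows "integral {0..x} (Bessel_integrand \<gamma> \<nu>) <
    (2 * \<nu> + 7) / ((2 * \<nu> + 1) * (1 - \<gamma>)) * exp (- \<gamma> * x) * x powr \<nu> * Bessel_I \<nu> x"
proof -
  define C where "C = (2 * \<nu> + 7) / ((2 * \<nu> + 1) * (1 - \<gamma>))"
  define D where "D = (\<lambda>t. exp (-\<gamma> * t) * t powr \<nu> *
      ((-\<gamma> + (\<nu> + \<nu>) / t) * Bessel_I \<nu> t + Bessel_I (\<nu> + 1) t))"
  \<comment> \<open>This is the value of y at which 2y/(2\<nu> + 1), the coefficient from the crude
    bound, reaches \<open>C\<close>.\<close>
  define x0 where "x0 = (\<nu> + 7 / 2) / (1 - \<gamma>)"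
  have x0: "x0 > 0" using assms by (simp add: x0_def)
  have "integral {0..x} (Bessel_integrand \<gamma> \<nu>) < C * (exp (-\<gamma> * x) * x powr \<nu> * Bessel_I \<nu> x)"
  proof (rule Bessel_integral_less_extend[where a = x0
        and \<Phi> = "\<lambda>x. C * (exp (-\<gamma> * x) * x powr \<nu> * Bessel_I \<nu> x)" and D = "\<lambda>t. C * D t"])
    fix t :: real assume "t > 0"
    thus "((\<lambda>x. C * (exp (-\<gamma> * x) * x powr \<nu> * Bessel_I \<nu> x)) has_real_derivative C * D t) (at t)"
      unfolding D_def using assms by (intro DERIV_cmult DERIV_exp_powr_Bessel_I) auto
  next
    fix y :: real assume y: "0 < y" "y \<le> x0"
    have "y * (Bessel_I \<nu> y + Bessel_I (\<nu> + 1) y) / (2 * \<nu> + 1) < 2 * y * Bessel_I \<nu> y / (2 * \<nu> + 1)"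
      using Bessel_I_Suc_less[of \<nu> y] assms y by (intro divide_strict_right_mono) auto
    also have "\<dots> \<le> 2 * x0 * Bessel_I \<nu> y / (2 * \<nu> + 1)"
      using Bessel_I_pos[of \<nu> y] assms y by (intro divide_right_mono mult_right_mono) auto
    also have "\<dots> = C * Bessel_I \<nu> y"
    proof -
      have "2 * x0 = (2 * \<nu> + 7) / (1 - \<gamma>)" 
        using assms by (simp add: x0_def divide_simps) (simp add: algebra_simps)
      thus ?thesis by (simp add: C_def)
    qed
    finally have "exp (-\<gamma> * y) * y powr \<nu> * (y * (Bessel_I \<nu> y + Bessel_I (\<nu> + 1) y) / (2 * \<nu> + 1))
        < exp (-\<gamma> * y) * y powr \<nu> * (C * Bessel_I \<nu> y)"
      using y by (intro mult_strict_left_mono) auto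
    with Bessel_integral_le[of \<nu> y \<gamma>] assms y
    show "integral {0..y} (Bessel_integrand \<gamma> \<nu>) < C * (exp (-\<gamma> * y) * y powr \<nu> * Bessel_I \<nu> y)"
      by (simp add: mult_ac)
  next
    fix t :: real assume t: "t > x0"
    hence t0: "t > 0" using x0 by simp
    \<comment> \<open>This bounds I(\<nu>+1, t) below by (1 - 2(\<nu>+1)/t) I(\<nu>, t). Together
      with the 2\<nu>/t in the derivative only -2/t survives, independent of \<nu>.\<close>
    have "Bessel_I \<nu> t \<le> Bessel_I (\<nu> + 1) t + 2 * (\<nu> + 1) / t * Bessel_I \<nu> t"
    proof -
      have "Bessel_I (\<nu> + 2) t \<le> Bessel_I (\<nu> + 1) t"
        using Bessel_I_Suc_less[of "\<nu> + 1" t] assms t0 by (simp add: add.commute)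
      moreover have "2 * (\<nu> + 1) / t * Bessel_I (\<nu> + 1) t \<le> 2 * (\<nu> + 1) / t * Bessel_I \<nu> t"
        using Bessel_I_Suc_less[of \<nu> t] assms t0 by (intro mult_left_mono) auto
      ultimately show ?thesis using Bessel_I_recurrence[of \<nu> t] assms t0 by linarith
    qed
    hence 1: "(1 - \<gamma> - 2 / t) * Bessel_I \<nu> t \<le> (-\<gamma> + (\<nu> + \<nu>) / t) * Bessel_I \<nu> t + Bessel_I (\<nu> + 1) t"
      by (simp add: algebra_simps add_divide_distrib)
    \<comment> \<open>Beyond \<open>x0\<close> the loss 2/t leaves at least the fraction (2\<nu> +
      3)/(2\<nu> + 7) of 1 - \<gamma>; multiplication by \<open>C\<close> turns this into (2\<nu> +
      3)/(2\<nu> + 1) > 1.\<close>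
    have "2 / t \<le> 2 / x0" using t x0 by (simp add: frac_le)
    also have "2 / x0 = 4 * (1 - \<gamma>) / (2 * \<nu> + 7)" using assms by (simp add: x0_def field_simps)
    finally have "(1 - \<gamma>) * ((2 * \<nu> + 3) / (2 * \<nu> + 7)) \<le> 1 - \<gamma> - 2 / t"
      using assms by (simp add: field_simps)
    moreover have C: "C > 0" using assms by (simp add: C_def)
    ultimately have "C * ((1 - \<gamma>) * ((2 * \<nu> + 3) / (2 * \<nu> + 7))) \<le> C * (1 - \<gamma> - 2 / t)"
      by (intro mult_left_mono) auto
    moreover have "C * ((1 - \<gamma>) * ((2 * \<nu> + 3) / (2 * \<nu> + 7))) = (2 * \<nu> + 3) / (2 * \<nu> + 1)"
      using assms by (simp add: C_def)
    moreover have "(2 * \<nu> + 3) / (2 * \<nu> + 1) \<ge> 1" using assms by simp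
    ultimately have "1 \<le> C * (1 - \<gamma> - 2 / t)" by linarith
    hence "1 * Bessel_I \<nu> t \<le> C * (1 - \<gamma> - 2 / t) * Bessel_I \<nu> t"
      using Bessel_I_pos[of \<nu> t] assms t0 by (intro mult_right_mono) auto
    also have "\<dots> \<le> C * ((-\<gamma> + (\<nu> + \<nu>) / t) * Bessel_I \<nu> t + Bessel_I (\<nu> + 1) t)"
      unfolding mult.assoc using 1 C by (intro mult_left_mono) auto
    finally have "exp (-\<gamma> * t) * t powr \<nu> * Bessel_I \<nu> t \<le> exp (-\<gamma> * t) * t powr \<nu> *
        (C * ((-\<gamma> + (\<nu> + \<nu>) / t) * Bessel_I \<nu> t + Bessel_I (\<nu> + 1) t))"
      by (intro mult_left_mono) auto
    thus "Bessel_integrand \<gamma> \<nu> t \<le> C * D t" by (simp only: Bessel_integrand_def D_def mult_ac)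
  qed (use assms x0 in auto)
  thus ?thesis by (simp only: C_def mult.assoc)
qed

section \<open>The lower bound and its tightness\<close>

text \<open>Seen from order \<nu> - 1, the exponent \<nu> is exactly the one that removes the 1/t
  term.\<close>

lemma DERIV_Bessel_integrand:
  assumes "\<nu> > 1/2" "t > 0"
  shows "(Bessel_integrand \<gamma> \<nu> has_real_derivative
    exp (-\<gamma> * t) * t powr \<nu> * (Bessel_I (\<nu> - 1) t - \<gamma> * Bessel_I \<nu> t)) (at t)"
  using DERIV_exp_powr_Bessel_I_Suc[of "\<nu> - 1" t "-\<gamma>" \<nu>] assms
  unfolding Bessel_integrand_def[abs_def] by (simp add: algebra_simps)

lemma continuous_on_Bessel_integrand: "\<nu> > 0 \<Longrightarrow> continuous_on {0..x} (Bessel_integrand \<gamma> \<nu>)"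
  unfolding Bessel_integrand_def[abs_def] by (intro continuous_on_exp_powr_Bessel_I) auto

text \<open>Since I(\<nu>, t) < I(\<nu>-1, t), the integrand's derivative is at least 1 - \<gamma>
  times the integrand. This is the upper half of the squeeze for tightness.\<close>

lemma Bessel_integral_upper:
  assumes "\<nu> > 1/2" "x > 0" "\<gamma> < 1"
  shows "integral {0..x} (Bessel_integrand \<gamma> \<nu>) \<le> Bessel_integrand \<gamma> \<nu> x / (1 - \<gamma>)"
proof -
  have "integral {0..x} (Bessel_integrand \<gamma> \<nu>) \<le>
      Bessel_integrand \<gamma> \<nu> x / (1 - \<gamma>) - Bessel_integrand \<gamma> \<nu> 0 / (1 - \<gamma>)"
  proof (rule integral_le_FTC)
    fix t assume t: "0 < t" "t < x"
    show "((\<lambda>t. Bessel_integrand \<gamma> \<nu> t / (1 - \<gamma>)) has_real_derivative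
        exp (-\<gamma> * t) * t powr \<nu> * (Bessel_I (\<nu> - 1) t - \<gamma> * Bessel_I \<nu> t) / (1 - \<gamma>)) (at t)"
      by (intro DERIV_cdivide DERIV_Bessel_integrand) (use assms t in auto)
    have "(1 - \<gamma>) * Bessel_I \<nu> t \<le> Bessel_I (\<nu> - 1) t - \<gamma> * Bessel_I \<nu> t"
      using Bessel_I_Suc_less[of "\<nu> - 1" t] assms t by (simp add: algebra_simps)
    hence "exp (-\<gamma> * t) * t powr \<nu> * ((1 - \<gamma>) * Bessel_I \<nu> t) \<le>
        exp (-\<gamma> * t) * t powr \<nu> * (Bessel_I (\<nu> - 1) t - \<gamma> * Bessel_I \<nu> t)"
      by (intro mult_left_mono) auto
    thus "Bessel_integrand \<gamma> \<nu> t \<le>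
        exp (-\<gamma> * t) * t powr \<nu> * (Bessel_I (\<nu> - 1) t - \<gamma> * Bessel_I \<nu> t) / (1 - \<gamma>)"
      using assms by (simp add: Bessel_integrand_def pos_le_divide_eq mult_ac)
  qed (use assms in \<open>auto intro!: continuous_on_divide continuous_on_Bessel_integrand
      Bessel_integrand_integrable\<close>)
  thus ?thesis by (simp add: Bessel_integrand_def)
qed

text \<open>The recurrence and monotonicity in the order give I(\<nu>-1, t) - I(\<nu>, t) \<le>
  (2\<nu>/t) I(\<nu>-1, t). The 1/t lowers the power of t, so the error is again an integrand of the
  same family, of order \<nu> - 1.\<close>

lemma Bessel_integral_ge:
  assumes "\<nu> > 1/2" "x > 0" "\<gamma> < 1"
  shows "integral {0..x} (Bessel_integrand \<gamma> \<nu>) \<ge> Bessel_integrand \<gamma> \<nu> x / (1 - \<gamma>)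
    - 2 * \<nu> / (1 - \<gamma>) * integral {0..x} (Bessel_integrand \<gamma> (\<nu> - 1))"
proof -
  have int: "Bessel_integrand \<gamma> \<nu> integrable_on {0..x}" "Bessel_integrand \<gamma> (\<nu> - 1) integrable_on {0..x}"
    using assms by (auto intro!: Bessel_integrand_integrable)
  \<comment> \<open>Signs are reversed because \<open>integral_le_FTC\<close> bounds integrals from
    above.\<close>
  have "integral {0..x} (\<lambda>t. - ((1 - \<gamma>) * Bessel_integrand \<gamma> \<nu> t + 2 * \<nu> * Bessel_integrand \<gamma> (\<nu> - 1) t))
      \<le> - Bessel_integrand \<gamma> \<nu> x - - Bessel_integrand \<gamma> \<nu> 0"
  proof (rule integral_le_FTC)
    fix t assume t: "0 < t" "t < x"
    show "((\<lambda>t. - Bessel_integrand \<gamma> \<nu> t) has_real_derivative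
        - (exp (-\<gamma> * t) * t powr \<nu> * (Bessel_I (\<nu> - 1) t - \<gamma> * Bessel_I \<nu> t))) (at t)"
      by (intro DERIV_minus DERIV_Bessel_integrand) (use assms t in auto)
    have "Bessel_I (\<nu> + 1) t < Bessel_I \<nu> t" "Bessel_I \<nu> t < Bessel_I (\<nu> - 1) t"
      using Bessel_I_Suc_less[of \<nu> t] Bessel_I_Suc_less[of "\<nu> - 1" t] assms t by auto
    moreover from this have "2 * \<nu> / t * Bessel_I \<nu> t \<le> 2 * \<nu> / t * Bessel_I (\<nu> - 1) t"
      using assms t by (intro mult_left_mono) auto
    ultimately have "Bessel_I (\<nu> - 1) t - \<gamma> * Bessel_I \<nu> t \<le>
        (1 - \<gamma>) * Bessel_I \<nu> t + 2 * \<nu> / t * Bessel_I (\<nu> - 1) t"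
      using Bessel_I_recurrence[of "\<nu> - 1" t] assms t by (simp add: algebra_simps)
    hence "exp (-\<gamma> * t) * t powr \<nu> * (Bessel_I (\<nu> - 1) t - \<gamma> * Bessel_I \<nu> t) \<le>
        exp (-\<gamma> * t) * t powr \<nu> * ((1 - \<gamma>) * Bessel_I \<nu> t + 2 * \<nu> / t * Bessel_I (\<nu> - 1) t)"
      by (intro mult_left_mono) auto
    also have "\<dots> = (1 - \<gamma>) * Bessel_integrand \<gamma> \<nu> t + 2 * \<nu> * Bessel_integrand \<gamma> (\<nu> - 1) t"
      using t by (simp add: Bessel_integrand_def powr_diff field_simps)
    finally show "- ((1 - \<gamma>) * Bessel_integrand \<gamma> \<nu> t + 2 * \<nu> * Bessel_integrand \<gamma> (\<nu> - 1) t)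
        \<le> - (exp (-\<gamma> * t) * t powr \<nu> * (Bessel_I (\<nu> - 1) t - \<gamma> * Bessel_I \<nu> t))" by simp
  next
    show "continuous_on {0..x} (\<lambda>t. - Bessel_integrand \<gamma> \<nu> t)"
      using assms by (intro continuous_on_minus continuous_on_Bessel_integrand) auto
    show "(\<lambda>t. - ((1 - \<gamma>) * Bessel_integrand \<gamma> \<nu> t + 2 * \<nu> * Bessel_integrand \<gamma> (\<nu> - 1) t))
        integrable_on {0..x}"
      by (intro integrable_neg integrable_add integrable_on_mult_right int)
  qed (use assms in auto)
  moreover have "integral {0..x}
      (\<lambda>t. - ((1 - \<gamma>) * Bessel_integrand \<gamma> \<nu> t + 2 * \<nu> * Bessel_integrand \<gamma> (\<nu> - 1) t)) =
      - ((1 - \<gamma>) * integral {0..x} (Bessel_integrand \<gamma> \<nu>)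
        + 2 * \<nu> * integral {0..x} (Bessel_integrand \<gamma> (\<nu> - 1)))"
    by (intro integral_unique has_integral_neg has_integral_add has_integral_mult_right
        integrable_integral int)
  moreover have "Bessel_integrand \<gamma> \<nu> 0 = 0" by (simp add: Bessel_integrand_def)
  ultimately have "Bessel_integrand \<gamma> \<nu> x - 2 * \<nu> * integral {0..x} (Bessel_integrand \<gamma> (\<nu> - 1))
      \<le> (1 - \<gamma>) * integral {0..x} (Bessel_integrand \<gamma> \<nu>)" by linarith
  hence "(Bessel_integrand \<gamma> \<nu> x - 2 * \<nu> * integral {0..x} (Bessel_integrand \<gamma> (\<nu> - 1))) / (1 - \<gamma>)
      \<le> integral {0..x} (Bessel_integrand \<gamma> \<nu>)"
    using assms by (simp add: pos_divide_le_eq mult.commute)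
  thus ?thesis by (simp add: diff_divide_distrib)
qed

lemma lower_bound_eq:
  "lower_bound \<gamma> \<nu> x = (1 - 4 * \<nu> * (2 * \<nu> + 5) / ((2 * \<nu> - 1) * (1 - \<gamma>)) / x)
    * (Bessel_integrand \<gamma> \<nu> x / (1 - \<gamma>))"
  by (simp add: lower_bound_def Bessel_integrand_def)

text \<open>The first upper bound at order \<nu> - 1 is already in terms of I(\<nu>, x), and its
  power x^(\<nu>-1) supplies the 1/x. The constant in \<open>lower_bound\<close> is its constant
  times the 2\<nu> of \<open>Bessel_integral_ge\<close>.\<close>

lemma lower_bound_less_Bessel_integral:
  assumes "\<nu> > 1/2" "x > 0" "0 < \<gamma>" "\<gamma> < 1"
  shows "lower_bound \<gamma> \<nu> x < integral {0..x} (Bessel_integrand \<gamma> \<nu>)"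
proof -
  have "integral {0..x} (Bessel_integrand \<gamma> (\<nu> - 1)) <
      2 * (2 * \<nu> + 5) / ((2 * \<nu> - 1) * (1 - \<gamma>)) * exp (-\<gamma> * x) * x powr (\<nu> - 1) * Bessel_I \<nu> x"
    using Bessel_integral_less_Suc[of "\<nu> - 1" x \<gamma>] assms by (simp add: algebra_simps)
  also have "\<dots> = 2 * (2 * \<nu> + 5) / ((2 * \<nu> - 1) * (1 - \<gamma>)) / x * Bessel_integrand \<gamma> \<nu> x"
    using assms by (simp add: Bessel_integrand_def powr_diff)
  finally have "2 * \<nu> / (1 - \<gamma>) * integral {0..x} (Bessel_integrand \<gamma> (\<nu> - 1)) <
      2 * \<nu> / (1 - \<gamma>) * (2 * (2 * \<nu> + 5) / ((2 * \<nu> - 1) * (1 - \<gamma>)) / x * Bessel_integrand \<gamma> \<nu> x)"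
    using assms by (intro mult_strict_left_mono) auto
  moreover have "lower_bound \<gamma> \<nu> x = Bessel_integrand \<gamma> \<nu> x / (1 - \<gamma>) -
      2 * \<nu> / (1 - \<gamma>) * (2 * (2 * \<nu> + 5) / ((2 * \<nu> - 1) * (1 - \<gamma>)) / x * Bessel_integrand \<gamma> \<nu> x)"
    unfolding lower_bound_eq by (simp add: algebra_simps)
  ultimately show ?thesis using Bessel_integral_ge[of \<nu> x \<gamma>] assms by linarith
qed

text \<open>For x beyond \<open>B\<close> the lower bound is positive, so the ratio can be squeezed
  between 1 and 1/(1 - B/x).\<close>

lemma lower_bound_tight:
  assumes "\<nu> > 1/2" "0 < \<gamma>" "\<gamma> < 1"
  shows "tight_at_infinity (\<lambda>x. integral {0..x} (Bessel_integrand \<gamma> \<nu>)) (lower_bound \<gamma> \<nu>)"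
proof -
  define B where "B = 4 * \<nu> * (2 * \<nu> + 5) / ((2 * \<nu> - 1) * (1 - \<gamma>))"
  have ev: "eventually (\<lambda>x. x > max 0 B) at_top" by (rule eventually_gt_at_top)
  have bounds: "1 \<le> integral {0..x} (Bessel_integrand \<gamma> \<nu>) / lower_bound \<gamma> \<nu> x"
    "integral {0..x} (Bessel_integrand \<gamma> \<nu>) / lower_bound \<gamma> \<nu> x \<le> 1 / (1 - B / x)"
    if x: "x > max 0 B" for x
  proof -
    let ?L = "Bessel_integrand \<gamma> \<nu> x / (1 - \<gamma>)"
    have L: "?L > 0" using assms x by (simp add: Bessel_integrand_def Bessel_I_pos)
    have B: "1 - B / x > 0" using x by simp
    have eq: "lower_bound \<gamma> \<nu> x = (1 - B / x) * ?L" by (simp add: lower_bound_eq B_def)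
    have pos: "lower_bound \<gamma> \<nu> x > 0" unfolding eq by (rule mult_pos_pos[OF B L])
    show "1 \<le> integral {0..x} (Bessel_integrand \<gamma> \<nu>) / lower_bound \<gamma> \<nu> x"
      using pos lower_bound_less_Bessel_integral[of \<nu> x \<gamma>] assms x by simp
    have "integral {0..x} (Bessel_integrand \<gamma> \<nu>) / lower_bound \<gamma> \<nu> x \<le> ?L / lower_bound \<gamma> \<nu> x"
      using pos Bessel_integral_upper[of \<nu> x \<gamma>] assms x by (intro divide_right_mono) auto
    also have "\<dots> = 1 / (1 - B / x)" unfolding eq using L by (metis div_by_1 divide_divide_eq_left less_numeral_extra(3) mult.commute nonzero_divide_mult_cancel_left)
    finally show "integral {0..x} (Bessel_integrand \<gamma> \<nu>) / lower_bound \<gamma> \<nu> x \<le> 1 / (1 - B / x)" .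
  qed
  have "((\<lambda>x. B / x) \<longlongrightarrow> 0) at_top"
    by (rule real_tendsto_divide_at_top[OF tendsto_const filterlim_ident])
  hence "((\<lambda>x. 1 / (1 - B / x)) \<longlongrightarrow> 1 / (1 - 0)) at_top"
    by (intro tendsto_intros) auto
  hence lim: "((\<lambda>x. 1 / (1 - B / x)) \<longlongrightarrow> 1) at_top" by simp
  show ?thesis unfolding tight_at_infinity_def
    by (rule tendsto_sandwich[OF _ _ tendsto_const lim])
      (rule eventually_mono[OF ev]; use bounds in blast)+
qed

text \<open>Integrability is asserted separately because \<open>integral\<close> is 0 by default on
  non-integrable functions; with it the inequalities concern genuine integrals.\<close>

theorem theorem2p2:
  fixes \<gamma> :: real
  assumes "0 < \<gamma>" and "\<gamma> < 1"
  shows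
    "(\<forall>\<nu> > -1/2. \<forall>x > 0. Bessel_integrand \<gamma> \<nu> integrable_on {0..x})
   \<and> (\<forall>\<nu> > -1/2. \<forall>x > 0.
        integral {0..x} (Bessel_integrand \<gamma> \<nu>)
          < 2 * (2 * \<nu> + 7) / ((2 * \<nu> + 1) * (1 - \<gamma>))
              * exp (- \<gamma> * x) * x powr \<nu> * Bessel_I (\<nu> + 1) x)
   \<and> (\<forall>\<nu> > -1/2. \<forall>x > 0.
        integral {0..x} (Bessel_integrand \<gamma> \<nu>)
          < (2 * \<nu> + 7) / ((2 * \<nu> + 1) * (1 - \<gamma>))
              * exp (- \<gamma> * x) * x powr \<nu> * Bessel_I \<nu> x)
   \<and> (\<forall>\<nu> > 1/2. \<forall>x > 0.
        integral {0..x} (Bessel_integrand \<gamma> \<nu>) > lower_bound \<gamma> \<nu> x)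
   \<and> (\<forall>\<nu> > 1/2.
        tight_at_infinity (\<lambda>x. integral {0..x} (Bessel_integrand \<gamma> \<nu>)) (lower_bound \<gamma> \<nu>))"
  using assms Bessel_integrand_integrable Bessel_integral_less_Suc Bessel_integral_less
    lower_bound_less_Bessel_integral lower_bound_tight
  by auto

end
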